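(* Let $A=a_1\cup\dots\cup a_n$ and $B=b_1\cup\dots\cup b_m$ be elements of $\mathcal{S}'(S)$ with $A\cup B$ filling $S$, and let $N=N_{A,B}$ be the $n\times m$ matrix whose $(i,j)$-entry is the geometric intersection number $i(a_i,b_j)$. Then, ordering the vertices of $\mathcal{G}(A\cup B)$ as $a_1,\dots,a_n,b_1,\dots,b_m$, the adjacency matrix is $$\mathcal{A}d(\mathcal{G}(A\cup B))=\begin{pmatrix}0&N\\N^t&0\end{pmatrix}.$$ In particular, $\mu(A\cup B)=\sqrt{\mu(NN^t)}=\mu(\mathcal{G}(A\cup B))$.
   Context: $S$ is a compact connected oriented surface with finitely many marked points (not a sphere with at most three marked points). $\mathcal{S}'(S)$: isotopy classes of closed embedded $1$-manifolds in $S$ minus marked points, all of whose components are homotopically essential and not isotopic to a puncture (parallel components allowed). Representatives of $A$ and $B$ are taken to meet transversely and minimally. $A\cup B$ fills $S$ if every essential simple closed curve has nonzero geometric intersection number with a component of $A$ or $B$. $\mathcal{G}(A\cup B)$ is the graph with one vertex per component of $A$ and $B$ and one edge for every point of intersection between corresponding components. The adjacency matrix $\mathcal{A}d(\mathcal{G})$ of a finite graph has $(i,j)$-entry the number of edges connecting the $i$th and $j$th vertices. For a square real matrix $M$, $\mu(M)$ is its spectral radius (maximum modulus of eigenvalues), and $\mu(\mathcal{G})=\mu(\mathcal{A}d(\mathcal{G}))$. By definition $\mu(A\cup B)=\sqrt{\mu(NN^t)}$. *)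

theory Defs
  imports "HOL-Analysis.Abstract_Topological_Spaces" "HOL-Homology.Homology"
    "Jordan_Normal_Form.Spectral_Radius"
begin

section \<open>Surfaces with marked points\<close>

definition topological_manifold :: "nat \<Rightarrow> 'a topology \<Rightarrow> bool" where
  "topological_manifold n X \<longleftrightarrow>
     Hausdorff_space X \<and> second_countable X \<and>
     (\<forall>x\<in>topspace X. \<exists>U V. openin X U \<and> x \<in> U \<and> openin (Euclidean_space n) V \<and>
        subtopology X U homeomorphic_space subtopology (Euclidean_space n) V)"

text \<open>An orientation of an \<open>n\<close>-manifold is a choice of a generator \<open>ori x\<close> of each local homology
  group \<open>H\<^sub>n(X, X - x)\<close> which is locally induced by a single class in \<open>H\<^sub>n(X, X - U)\<close>.\<close>

definition orientation :: "nat \<Rightarrow> 'a topology \<Rightarrow> ('a \<Rightarrow> 'a chain set) \<Rightarrow> bool" where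
  "orientation n X ori \<longleftrightarrow>
     (\<forall>x\<in>topspace X.
        let H = relative_homology_group (int n) X (topspace X - {x})
        in ori x \<in> carrier H \<and> generate H {ori x} = carrier H) \<and>
     (\<forall>x\<in>topspace X. \<exists>U c. openin X U \<and> x \<in> U \<and>
        c \<in> carrier (relative_homology_group (int n) X (topspace X - U)) \<and>
        (\<forall>y\<in>U. hom_induced (int n) X (topspace X - U) X (topspace X - {y}) id c = ori y))"

text \<open>Surfaces have no boundary; \<open>P\<close> is the set of marked points. Spheres with at most three
  marked points are excluded.\<close>

definition marked_surface :: "'a topology \<Rightarrow> ('a \<Rightarrow> 'a chain set) \<Rightarrow> 'a set \<Rightarrow> bool" where
  "marked_surface X ori P \<longleftrightarrow>
     topological_manifold 2 X \<and> topspace X \<noteq> {} \<and> compact_space X \<and> connected_space X \<and>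
     orientation 2 X ori \<and> P \<subseteq> topspace X \<and> finite P \<and>
     \<not> (X homeomorphic_space nsphere 2 \<and> card P \<le> 3)"

abbreviation punctured :: "'a topology \<Rightarrow> 'a set \<Rightarrow> 'a topology" where
  "punctured X P \<equiv> subtopology X (topspace X - P)"


section \<open>Curves and closed 1-manifolds\<close>

text \<open>Everything is done in the topological category. By the Schoenflies theorem, closed
  1-manifolds embedded in a surface are locally flat. Isotopies avoid the marked points.\<close>

definition isotopic :: "'a topology \<Rightarrow> 'a set \<Rightarrow> 'a set \<Rightarrow> 'a set \<Rightarrow> bool" where
  "isotopic X P C D \<longleftrightarrow>
     (\<exists>g. homotopic_with (embedding_map (subtopology X C) (punctured X P))
            (subtopology X C) (punctured X P) id g \<and> g ` C = D)"

definition simple_closed_curve :: "'a topology \<Rightarrow> 'a set \<Rightarrow> 'a set \<Rightarrow> bool" where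
  "simple_closed_curve X P c \<longleftrightarrow>
     c \<subseteq> topspace X - P \<and> subtopology X c homeomorphic_space nsphere 1"

definition null_homotopic :: "'a topology \<Rightarrow> 'a set \<Rightarrow> 'a set \<Rightarrow> bool" where
  "null_homotopic X P c \<longleftrightarrow>
     (\<exists>z. homotopic_with (\<lambda>_. True) (subtopology X c) (punctured X P) id (\<lambda>_. z))"

text \<open>The isotopy to a puncture stays embedded in the complement of the marked points
  up to the final time, when the curve collapses to a marked point.\<close>

definition isotopic_to_puncture :: "'a topology \<Rightarrow> 'a set \<Rightarrow> 'a set \<Rightarrow> bool" where
  "isotopic_to_puncture X P c \<longleftrightarrow>
     (\<exists>p\<in>P. \<exists>h. continuous_map (prod_topology (top_of_set {0..1::real}) (subtopology X c)) X h \<and>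
        (\<forall>x\<in>c. h (0, x) = x \<and> h (1, x) = p) \<and>
        (\<forall>t\<in>{0..<1}. embedding_map (subtopology X c) (punctured X P) (\<lambda>x. h (t, x))))"

definition essential :: "'a topology \<Rightarrow> 'a set \<Rightarrow> 'a set \<Rightarrow> bool" where
  "essential X P c \<longleftrightarrow>
     simple_closed_curve X P c \<and> \<not> null_homotopic X P c \<and> \<not> isotopic_to_puncture X P c"

abbreviation comps :: "'a topology \<Rightarrow> 'a set \<Rightarrow> 'a set set" where
  "comps X C \<equiv> connected_components_of (subtopology X C)"

definition multicurve :: "'a topology \<Rightarrow> 'a set \<Rightarrow> 'a set \<Rightarrow> bool" where
  "multicurve X P C \<longleftrightarrow>
     C \<subseteq> topspace X - P \<and> compactin X C \<and> topological_manifold 1 (subtopology X C) \<and>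
     (\<forall>c\<in>comps X C. essential X P c)"

text \<open>The set \<open>S'(S)\<close> of isotopy classes.\<close>

definition multicurve_classes :: "'a topology \<Rightarrow> 'a set \<Rightarrow> 'a set set set" where
  "multicurve_classes X P =
     {C. multicurve X P C} //
     {(C, D). multicurve X P C \<and> multicurve X P D \<and> isotopic X P C D}"


section \<open>Intersections\<close>

definition transverse :: "'a topology \<Rightarrow> 'a set \<Rightarrow> 'a set \<Rightarrow> bool" where
  "transverse X A B \<longleftrightarrow>
     (\<forall>x\<in>A \<inter> B. \<exists>U \<phi>. openin X U \<and> x \<in> U \<and>
        homeomorphic_map (subtopology X U) (Euclidean_space 2) \<phi> \<and>
        \<phi> ` (A \<inter> U) = {z \<in> topspace (Euclidean_space 2). z 0 = 0} \<and>
        \<phi> ` (B \<inter> U) = {z \<in> topspace (Euclidean_space 2). z 1 = 0})"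

text \<open>The finiteness condition is needed since \<open>card\<close> of an infinite set is \<open>0\<close>.\<close>

definition geometric_intersection :: "'a topology \<Rightarrow> 'a set \<Rightarrow> 'a set \<Rightarrow> 'a set \<Rightarrow> nat" where
  "geometric_intersection X P a b =
     (LEAST k. \<exists>a' b'. isotopic X P a a' \<and> isotopic X P b b' \<and>
        finite (a' \<inter> b') \<and> card (a' \<inter> b') = k)"

text \<open>Minimality is understood componentwise: the geometric intersection number is a notion for
  pairs of curves, and each component of \<open>A\<close> meets each component of \<open>B\<close> in the least possible
  number of points.\<close>

definition meet_minimally :: "'a topology \<Rightarrow> 'a set \<Rightarrow> 'a set \<Rightarrow> 'a set \<Rightarrow> bool" where
  "meet_minimally X P A B \<longleftrightarrow>
     (\<forall>a\<in>comps X A. \<forall>b\<in>comps X B.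
        finite (a \<inter> b) \<and> card (a \<inter> b) = geometric_intersection X P a b)"

definition fills :: "'a topology \<Rightarrow> 'a set \<Rightarrow> 'a set \<Rightarrow> 'a set \<Rightarrow> bool" where
  "fills X P A B \<longleftrightarrow>
     (\<forall>c. essential X P c \<longrightarrow>
        (\<exists>d\<in>comps X A \<union> comps X B. geometric_intersection X P c d \<noteq> 0))"

definition intersection_matrix ::
  "'a topology \<Rightarrow> 'a set \<Rightarrow> 'a set list \<Rightarrow> 'a set list \<Rightarrow> real mat" where
  "intersection_matrix X P as bs =
     Matrix.mat (length as) (length bs)
       (\<lambda>(i, j). real (geometric_intersection X P (as ! i) (bs ! j)))"


section \<open>Graphs and spectral radii\<close>

text \<open>Finite undirected graphs with multiple edges: \<open>ends e\<close> is the set of end points of \<open>e\<close>.\<close>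

record ('v, 'e) multigraph =
  verts :: "'v set"
  edges :: "'e set"
  ends :: "'e \<Rightarrow> 'v set"

definition enumerates :: "'v list \<Rightarrow> 'v set \<Rightarrow> bool" where
  "enumerates vs V \<longleftrightarrow> distinct vs \<and> set vs = V"

definition adjacency_matrix :: "('v, 'e) multigraph \<Rightarrow> 'v list \<Rightarrow> real mat" where
  "adjacency_matrix G vs =
     Matrix.mat (length vs) (length vs)
       (\<lambda>(i, j). real (card {e \<in> edges G. ends G e = {vs ! i, vs ! j}}))"

text \<open>The components of a 1-manifold are disjoint, so that a point of \<open>A \<inter> B\<close> lies on exactly one
  component of \<open>A\<close> and one of \<open>B\<close>; these are the end points of the edge given by this point.\<close>

definition intersection_graph ::
  "'a topology \<Rightarrow> 'a set \<Rightarrow> 'a set \<Rightarrow> ('a set + 'a set, 'a) multigraph" where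
  "intersection_graph X A B =
     \<lparr> verts = comps X A <+> comps X B,
       edges = A \<inter> B,
       ends = (\<lambda>x. {Inl (connected_component_of_set (subtopology X A) x),
                    Inr (connected_component_of_set (subtopology X B) x)}) \<rparr>"

text \<open>The empty matrix has no eigenvalues; its spectral radius is \<open>0\<close> by convention.\<close>

definition mu :: "real mat \<Rightarrow> real" where
  "mu M = (if dim_row M = 0 then 0 else spectral_radius (map_mat complex_of_real M))"

text \<open>The next two quantities do not depend on the chosen enumerations.\<close>

definition mu_graph :: "('v, 'e) multigraph \<Rightarrow> real" where
  "mu_graph G = mu (adjacency_matrix G (SOME vs. enumerates vs (verts G)))"

definition mu_union :: "'a topology \<Rightarrow> 'a set \<Rightarrow> 'a set \<Rightarrow> 'a set \<Rightarrow> real" where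
  "mu_union X P A B =
     (let N = intersection_matrix X P
                (SOME as. enumerates as (comps X A)) (SOME bs. enumerates bs (comps X B))
      in sqrt (mu (N * transpose_mat N)))"

end

theory Submission
  imports Defs "HOL-Combinatorics.List_Permutation"
begin

text \<open>An edge between \<open>a\<close> and \<open>b\<close> is a point of \<open>a \<inter> b\<close>, since a point of \<open>A \<inter> B\<close> lies on exactly
  one component of each; minimal position turns the number of these points into the geometric
  intersection number. For the spectral radii, an eigenvector \<open>(x, y)\<close> of the block matrix
  with eigenvalue \<open>k\<close> satisfies \<open>N y = k x\<close> and \<open>N\<^sup>t x = k y\<close>, so that \<open>N N\<^sup>t x = k\<^sup>2 x\<close>; conversely, if
  \<open>N N\<^sup>t x = k\<^sup>2 x\<close> with \<open>k \<noteq> 0\<close>, then \<open>(k x, N\<^sup>t x)\<close> is an eigenvector with eigenvalue \<open>k\<close>.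
  Reordering the components permutes the coordinates of eigenvectors.\<close>

section \<open>Spectral radius and eigenvalues\<close>

lemma eigenvalue_le_mu:
  assumes M: "M \<in> carrier_mat n n" and k: "eigenvalue (map_mat complex_of_real M) k"
  shows "norm k \<le> mu M"
proof -
  \<comment> \<open>An eigenvector is nonzero, which excludes the empty matrix and with it the
    conventional value of \<open>mu\<close>.\<close>
  have "n \<noteq> 0"
  proof
    assume "n = 0"
    with k M show False by (auto simp: eigenvalue_def eigenvector_def)
  qed
  moreover have "norm k \<in> norm ` spectrum (map_mat complex_of_real M)"
    using k by (auto simp: spectrum_def)
  ultimately show ?thesis
    using spectral_radius_mem_max(2)[of "map_mat complex_of_real M" n] M by (auto simp: mu_def)
qed

text \<open>The value 0 is a separate case because the empty matrix has no eigenvalue attaining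
  it.\<close>

lemma mu_cases:
  assumes M: "M \<in> carrier_mat n n"
  obtains "mu M = 0" | k where "eigenvalue (map_mat complex_of_real M) k" "mu M = norm k"
proof (cases "n = 0")
  case True
  with M that show ?thesis by (simp add: mu_def)
next
  case False
  with spectral_radius_mem_max(1)[of "map_mat complex_of_real M" n] M that show ?thesis
    by (auto simp: mu_def spectrum_def)
qed

lemma mu_nonneg: "M \<in> carrier_mat n n \<Longrightarrow> 0 \<le> mu M"
  by (metis mu_cases norm_ge_zero order_refl)

section \<open>Independence of the chosen enumerations\<close>

text \<open>A leading eigenvector is carried over by permuting its coordinates. Entries come from a
  function \<open>F\<close> of the labels, so that adjacency matrices and
  \<open>N * transpose_mat N\<close> are both covered.\<close>

lemma mu_le_mu_permuted:
  fixes F :: "'v \<Rightarrow> 'v \<Rightarrow> real"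
  assumes "enumerates vs V" and "enumerates ws V"
  shows "mu (Matrix.mat (length vs) (length vs) (\<lambda>(i, j). F (vs ! i) (vs ! j)))
       \<le> mu (Matrix.mat (length ws) (length ws) (\<lambda>(i, j). F (ws ! i) (ws ! j)))"
    (is "mu ?M \<le> mu ?L")
proof (cases rule: mu_cases[OF mat_carrier, of "length vs" "\<lambda>(i, j). F (vs ! i) (vs ! j)"])
  case 1
  then show ?thesis using mu_nonneg[of ?L "length ws"] by simp
next
  case (2 k)
  define n where "n = length vs"
  have n: "length ws = n"
    using assms unfolding n_def enumerates_def by (metis distinct_card)
  have "mset ws = mset vs"
    using assms by (metis enumerates_def set_eq_iff_mset_eq_distinct)
  then obtain f where f: "bij_betw f {..<n} {..<n}" and ws: "\<And>i. i < n \<Longrightarrow> ws ! i = vs ! f i"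
    using permutation_Ex_bij[of ws vs] n n_def by auto
  have f': "bij_betw f {0..<n} {0..<n}" using f by (simp add: atLeast0LessThan)
  have f_less: "f i < n" if "i < n" for i using bij_betwE[OF f] that by simp
  obtain v where v: "v \<in> carrier_vec n" "v \<noteq> 0\<^sub>v n"
    and kv: "map_mat complex_of_real ?M *\<^sub>v v = k \<cdot>\<^sub>v v"
    using 2 by (auto simp: eigenvalue_def eigenvector_def n_def)
  have entry: "(\<Sum>j\<in>{0..<n}. of_real (F (vs ! i) (vs ! j)) * v $ j) = k * v $ i" if "i < n" for i
    using arg_cong[OF kv, of "\<lambda>u. u $ i"] that v(1) by (simp add: scalar_prod_def n_def[symmetric])
  \<comment> \<open>As \<open>ws ! i = vs ! f i\<close>, this is \<open>v\<close> with its
    coordinates listed in the order of \<open>ws\<close>.\<close>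
  define w where "w = Matrix.vec n (\<lambda>i. v $ f i)"
  have "map_mat complex_of_real ?L *\<^sub>v w = k \<cdot>\<^sub>v w"
  proof (rule eq_vecI)
    fix i assume "i < dim_vec (k \<cdot>\<^sub>v w)"
    then have i: "i < n" by (simp add: w_def)
    have "(map_mat complex_of_real ?L *\<^sub>v w) $ i
        = (\<Sum>j\<in>{0..<n}. of_real (F (vs ! f i) (vs ! f j)) * v $ f j)"
      using i by (simp add: scalar_prod_def n w_def ws)
    also have "\<dots> = (\<Sum>j\<in>{0..<n}. of_real (F (vs ! f i) (vs ! j)) * v $ j)"
      by (rule sum.reindex_bij_betw[OF f'])
    also have "\<dots> = (k \<cdot>\<^sub>v w) $ i"
      using entry[OF f_less[OF i]] i by (simp add: w_def)
    finally show "(map_mat complex_of_real ?L *\<^sub>v w) $ i = (k \<cdot>\<^sub>v w) $ i" .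
  qed (simp add: w_def n)
  moreover have "w \<noteq> 0\<^sub>v n"
  proof
    assume "w = 0\<^sub>v n"
    then have zero: "v $ f i = 0" if "i < n" for i
      using that by (metis index_vec index_zero_vec(1) w_def)
    \<comment> \<open>Since \<open>f\<close> is onto, every coordinate of \<open>v\<close> occurs in
      \<open>w\<close>.\<close>
    have "v $ j = 0" if "j < n" for j
      using zero that f unfolding bij_betw_def by (metis imageE lessThan_iff)
    with v show False by (auto intro!: eq_vecI)
  qed
  ultimately have "eigenvalue (map_mat complex_of_real ?L) k"
    by (auto simp: eigenvalue_def eigenvector_def n w_def intro!: exI[of _ w])
  with 2(2) show ?thesis
    using eigenvalue_le_mu[of ?L "length ws"] by simp
qed

lemma mu_permuted:
  fixes F :: "'v \<Rightarrow> 'v \<Rightarrow> real"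
  assumes "enumerates vs V" and "enumerates ws V"
  shows "mu (Matrix.mat (length vs) (length vs) (\<lambda>(i, j). F (vs ! i) (vs ! j)))
       = mu (Matrix.mat (length ws) (length ws) (\<lambda>(i, j). F (ws ! i) (ws ! j)))"
  using assms by (intro antisym mu_le_mu_permuted)

lemma enumerates_SOME: "enumerates vs V \<Longrightarrow> enumerates (SOME vs. enumerates vs V) V"
  by (rule someI)

lemma mu_graph_eq:
  assumes "enumerates vs (verts G)"
  shows "mu_graph G = mu (adjacency_matrix G vs)"
  unfolding mu_graph_def adjacency_matrix_def
  by (rule mu_permuted[OF enumerates_SOME[OF assms] assms,
      of "\<lambda>v w. real (card {e \<in> edges G. ends G e = {v, w}})"])

text \<open>Summing over the set \<open>V\<close> instead of positions removes the order of
  \<open>bs\<close> and leaves a function of two row labels, the form that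
  \<open>mu_permuted\<close> expects.\<close>

lemma intersection_matrix_gram:
  assumes "enumerates bs V"
  shows "intersection_matrix X P as bs * transpose_mat (intersection_matrix X P as bs) =
    Matrix.mat (length as) (length as)
      (\<lambda>(i, j). \<Sum>b\<in>V. real (geometric_intersection X P (as ! i) b) *
                      real (geometric_intersection X P (as ! j) b))"
proof -
  have "bij_betw ((!) bs) {0..<length bs} V"
    using assms bij_betw_nth[of bs "{0..<length bs}" V]
    by (simp add: enumerates_def atLeast0LessThan)
  from sum.reindex_bij_betw[OF this] show ?thesis
    by (intro eq_matI) (simp_all add: intersection_matrix_def scalar_prod_def)
qed

text \<open>Once both products are written as sums over \<open>comps X B\<close>, they differ only
  in the order of the components of \<open>A\<close>.\<close>

lemma mu_union_eq:
  assumes as: "enumerates as (comps X A)" and bs: "enumerates bs (comps X B)"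
    and N: "N = intersection_matrix X P as bs"
  shows "mu_union X P A B = sqrt (mu (N * transpose_mat N))"
  unfolding mu_union_def Let_def N intersection_matrix_gram[OF bs]
    intersection_matrix_gram[OF enumerates_SOME[OF bs]]
  by (rule arg_cong[OF mu_permuted[OF enumerates_SOME[OF as] as,
      of "\<lambda>a a'. \<Sum>b\<in>comps X B. real (geometric_intersection X P a b) *
                              real (geometric_intersection X P a' b)"]])

section \<open>Eigenvalues of the bipartite block matrix\<close>

lemma mu_bipartite:
  assumes N: "N \<in> carrier_mat n m"
  shows "mu (four_block_mat (0\<^sub>m n n) N (transpose_mat N) (0\<^sub>m m m))
       = sqrt (mu (N * transpose_mat N))" (is "mu ?L = sqrt (mu ?K)")
proof -
  let ?N = "map_mat complex_of_real N"
  let ?T = "transpose_mat ?N"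
  have carr: "?N \<in> carrier_mat n m" "?T \<in> carrier_mat m n" using N by auto
  have K: "?K \<in> carrier_mat n n" and L: "?L \<in> carrier_mat (n + m) (n + m)" using N by auto
  have cK: "map_mat complex_of_real ?K = ?N * ?T"
    using N by (simp add: of_real_hom.mat_hom_mult[of _ n m] map_mat_transpose)
  have cL: "map_mat complex_of_real ?L = four_block_mat (0\<^sub>m n n) ?N ?T (0\<^sub>m m m)"
    using N by (subst map_four_block_mat[of _ n n _ m _ m]) (auto simp: map_mat_transpose)
  have block: "map_mat complex_of_real ?L *\<^sub>v (x @\<^sub>v y) = (?N *\<^sub>v y) @\<^sub>v (?T *\<^sub>v x)"
    if x: "x \<in> carrier_vec n" and y: "y \<in> carrier_vec m" for x y
  proof -
    have "0\<^sub>m n n *\<^sub>v x = 0\<^sub>v n" "0\<^sub>m m m *\<^sub>v y = 0\<^sub>v m" using x y by auto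
    moreover have "?N *\<^sub>v y \<in> carrier_vec n" "?T *\<^sub>v x \<in> carrier_vec m"
      using mult_mat_vec_carrier carr x y by blast+
    ultimately show ?thesis
      unfolding cL
      by (subst four_block_mat_mult_vec[OF zero_carrier_mat carr zero_carrier_mat x y]) simp
  qed
  have smult_append: "k \<cdot>\<^sub>v (x @\<^sub>v y) = k \<cdot>\<^sub>v x @\<^sub>v k \<cdot>\<^sub>v y" for k :: complex and x y
    by (rule eq_vecI) auto
  have zero_append: "0\<^sub>v (n + m) = 0\<^sub>v n @\<^sub>v (0\<^sub>v m :: complex vec)"
    by (rule eq_vecI) auto
  have NT: "(?N * ?T) *\<^sub>v x = ?N *\<^sub>v (?T *\<^sub>v x)" if "x \<in> carrier_vec n" for x
    using carr that by (rule assoc_mult_mat_vec)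
  have "mu ?L \<le> sqrt (mu ?K)"
  proof (cases rule: mu_cases[OF L])
    case 1
    then show ?thesis using mu_nonneg[OF K] by simp
  next
    case (2 k)
    then obtain v where v: "v \<in> carrier_vec (n + m)" "v \<noteq> 0\<^sub>v (n + m)"
      and kv: "map_mat complex_of_real ?L *\<^sub>v v = k \<cdot>\<^sub>v v"
      using L by (auto simp: eigenvalue_def eigenvector_def)
    obtain x y where xy: "x \<in> carrier_vec n" "y \<in> carrier_vec m" "v = x @\<^sub>v y"
      using v(1) by (metis vec_first_carrier vec_first_last_append vec_last_carrier)
    have "(?N *\<^sub>v y) @\<^sub>v (?T *\<^sub>v x) = k \<cdot>\<^sub>v x @\<^sub>v k \<cdot>\<^sub>v y"
      using kv xy by (simp add: block smult_append)
    then have Ny: "?N *\<^sub>v y = k \<cdot>\<^sub>v x" and Tx: "?T *\<^sub>v x = k \<cdot>\<^sub>v y"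
      using xy N append_vec_eq[of "?N *\<^sub>v y" n "k \<cdot>\<^sub>v x"] by auto
    show ?thesis
    \<comment> \<open>If \<open>x\<close> vanishes, it is no eigenvector of \<open>?N * ?T\<close>;
      but then \<open>y\<close> is nonzero and \<open>k\<close> times \<open>y\<close> is zero, so
      \<open>k = 0\<close> and nonnegativity suffices.\<close>
    proof (cases "x = 0\<^sub>v n")
      case True
      then have "y \<noteq> 0\<^sub>v m" using v(2) xy zero_append by auto
      moreover have "?T *\<^sub>v 0\<^sub>v n = 0\<^sub>v m"
        using N by (intro eq_vecI) (auto simp: scalar_prod_def)
      then have "k \<cdot>\<^sub>v y = 0\<^sub>v m" using Tx True by simp
      ultimately have "k = 0" using xy(2)
        by (metis (no_types) carrier_vecD eq_vecI index_smult_vec(1) index_zero_vec mult_eq_0_iff)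
      then show ?thesis using 2 mu_nonneg[OF K] by simp
    next
      case False
      have "(?N * ?T) *\<^sub>v x = k\<^sup>2 \<cdot>\<^sub>v x"
        using carr xy by (simp add: NT Tx mult_mat_vec[of _ n m] Ny smult_smult_assoc power2_eq_square)
      then have "eigenvalue (map_mat complex_of_real ?K) (k\<^sup>2)"
        using False xy N unfolding cK by (auto simp: eigenvalue_def eigenvector_def)
      then have "(norm k)\<^sup>2 \<le> mu ?K"
        using eigenvalue_le_mu[OF K] by (metis norm_power)
      with 2 show ?thesis by (simp add: real_le_rsqrt)
    qed
  qed
  moreover have "sqrt (mu ?K) \<le> mu ?L"
  proof (cases rule: mu_cases[OF K])
    case 1
    then show ?thesis using mu_nonneg[OF L] by simp
  next
    case (2 l)
    \<comment> \<open>At this point \<open>l\<close> is merely a complex number, hence the complex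
      root; \<open>l = k\<^sup>2\<close> makes the modulus of \<open>k\<close> the square root of
      \<open>mu ?K\<close>.\<close>
    define k where "k = csqrt l"
    have l: "l = k\<^sup>2" by (simp add: k_def)
    show ?thesis
    proof (cases "k = 0")
      case True
      then show ?thesis using 2 l mu_nonneg[OF L] by simp
    next
      case False
      obtain x where x: "x \<in> carrier_vec n" "x \<noteq> 0\<^sub>v n" and lx: "(?N * ?T) *\<^sub>v x = l \<cdot>\<^sub>v x"
        using 2 N unfolding cK by (auto simp: eigenvalue_def eigenvector_def)
      have y: "?T *\<^sub>v x \<in> carrier_vec m" using mult_mat_vec_carrier carr x by blast
      have "?N *\<^sub>v (?T *\<^sub>v x) = k \<cdot>\<^sub>v (k \<cdot>\<^sub>v x)"
        using NT[OF x(1)] lx by (simp only: l smult_smult_assoc power2_eq_square)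
      moreover have "?T *\<^sub>v (k \<cdot>\<^sub>v x) = k \<cdot>\<^sub>v (?T *\<^sub>v x)"
        by (rule mult_mat_vec[OF carr(2) x(1)])
      \<comment> \<open>The factor \<open>k\<close> on \<open>x\<close> balances the halves: the
        upper one becomes \<open>k\<^sup>2\<close> times \<open>x\<close>, the lower one
        \<open>k\<close> times \<open>?T *\<^sub>v x\<close>.\<close>
      ultimately have "map_mat complex_of_real ?L *\<^sub>v (k \<cdot>\<^sub>v x @\<^sub>v ?T *\<^sub>v x)
          = k \<cdot>\<^sub>v (k \<cdot>\<^sub>v x @\<^sub>v ?T *\<^sub>v x)"
        by (simp only: block[OF smult_carrier_vec[THEN iffD2, OF x(1)] y] smult_append)
      \<comment> \<open>Here \<open>k \<noteq> 0\<close> enters: the upper half alone keeps the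
        vector nonzero.\<close>
      moreover have "k \<cdot>\<^sub>v x \<noteq> 0\<^sub>v n"
        using False x
        by (metis (no_types) carrier_vecD eq_vecI index_smult_vec(1) index_zero_vec mult_eq_0_iff)
      then have "k \<cdot>\<^sub>v x @\<^sub>v ?T *\<^sub>v x \<noteq> 0\<^sub>v (n + m)"
        using x unfolding zero_append by (subst append_vec_eq[of _ n]) auto
      ultimately have "eigenvalue (map_mat complex_of_real ?L) k"
        using x y L unfolding eigenvalue_def eigenvector_def
        by (intro exI[of _ "k \<cdot>\<^sub>v x @\<^sub>v ?T *\<^sub>v x"]) auto
      from eigenvalue_le_mu[OF L this] 2 l show ?thesis
        by (simp add: norm_power)
    qed
  qed
  ultimately show ?thesis by (rule antisym)
qed

section \<open>Edges of the intersection graph\<close>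

text \<open>Components partition the space. This turns membership into the kind of equation that
  \<open>ends\<close> produces.\<close>

lemma in_comps_iff:
  assumes "c \<in> connected_components_of Y" and "x \<in> topspace Y"
  shows "x \<in> c \<longleftrightarrow> connected_component_of_set Y x = c"
  using assms
  by (auto simp: connected_components_of_def connected_component_of_equiv connected_component_of_refl)

text \<open>The relation behind the quotient holds only between multicurves, so every member of a
  class is one.\<close>

lemma multicurve_classes_subset:
  assumes "\<A> \<in> multicurve_classes X P" and "A \<in> \<A>"
  shows "A \<subseteq> topspace X"
  using assms by (auto simp: multicurve_classes_def quotient_def multicurve_def)

text \<open>The tags \<open>Inl\<close> and \<open>Inr\<close> split the equality of unordered pairs
  into one equation per side, which says that the point lies on \<open>a\<close> and on
  \<open>b\<close>.\<close>

lemma intersection_graph_edges_between: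
  assumes "A \<subseteq> topspace X" "B \<subseteq> topspace X" and a: "a \<in> comps X A" and b: "b \<in> comps X B"
  shows "{e \<in> edges (intersection_graph X A B). ends (intersection_graph X A B) e = {Inl a, Inr b}}
       = a \<inter> b"
proof -
  have top: "topspace (subtopology X A) = A" "topspace (subtopology X B) = B"
    using assms by auto
  have "a \<subseteq> A" "b \<subseteq> B"
    using connected_components_of_subset[OF a] connected_components_of_subset[OF b] top by auto
  moreover have "x \<in> a \<longleftrightarrow> connected_component_of_set (subtopology X A) x = a" if "x \<in> A" for x
    using in_comps_iff[OF a, of x] that unfolding top by blast
  moreover have "x \<in> b \<longleftrightarrow> connected_component_of_set (subtopology X B) x = b" if "x \<in> B" for x
    using in_comps_iff[OF b, of x] that unfolding top by blast
  ultimately show ?thesis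
    by (auto simp: intersection_graph_def doubleton_eq_iff)
qed

text \<open>Each edge has one end of either tag. The case of equal vertices is included, so the
  diagonal entries vanish too.\<close>

lemma intersection_graph_no_edges:
  "{e \<in> edges (intersection_graph X A B). ends (intersection_graph X A B) e = {Inl a, Inl a'}} = {}"
  "{e \<in> edges (intersection_graph X A B). ends (intersection_graph X A B) e = {Inr b, Inr b'}} = {}"
  by (auto simp: intersection_graph_def doubleton_eq_iff)

lemma adjacency_matrix_intersection_graph:
  assumes sub: "A \<subseteq> topspace X" "B \<subseteq> topspace X" and min: "meet_minimally X P A B"
    and as: "enumerates as (comps X A)" and bs: "enumerates bs (comps X B)"
    and N: "N = intersection_matrix X P as bs"
  shows "adjacency_matrix (intersection_graph X A B) (map Inl as @ map Inr bs) =
    four_block_mat (0\<^sub>m (length as) (length as)) N (transpose_mat N) (0\<^sub>m (length bs) (length bs))"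
proof (rule eq_matI)
  let ?G = "intersection_graph X A B"
  let ?E = "\<lambda>u v. card {e \<in> edges ?G. ends ?G e = {u, v}}"
  \<comment> \<open>Minimal position is used here, one pair of components at a time.\<close>
  have ab: "?E (Inl a) (Inr b) = geometric_intersection X P a b"
    if "a \<in> set as" "b \<in> set bs" for a b
    using that min as bs intersection_graph_edges_between[OF sub, of a b]
    by (simp add: enumerates_def meet_minimally_def)
  \<comment> \<open>End points are unordered; this gives the transposed block.\<close>
  have ba: "?E (Inr b) (Inl a) = geometric_intersection X P a b"
    if "a \<in> set as" "b \<in> set bs" for a b
    using ab[OF that] by (simp add: insert_commute)
  fix i j
  assume "i < dim_row (four_block_mat (0\<^sub>m (length as) (length as)) N (transpose_mat N)
                         (0\<^sub>m (length bs) (length bs)))"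
    and "j < dim_col (four_block_mat (0\<^sub>m (length as) (length as)) N (transpose_mat N)
                         (0\<^sub>m (length bs) (length bs)))"
  then have ij: "i < length as + length bs" "j < length as + length bs" by auto
  then show "adjacency_matrix ?G (map Inl as @ map Inr bs) $$ (i, j) =
    four_block_mat (0\<^sub>m (length as) (length as)) N (transpose_mat N)
      (0\<^sub>m (length bs) (length bs)) $$ (i, j)"
    by (cases "i < length as"; cases "j < length as")
      (simp_all add: adjacency_matrix_def N intersection_matrix_def nth_append ab ba
        intersection_graph_no_edges del: Collect_empty_eq)
qed (simp_all add: adjacency_matrix_def)

theorem proposition5p1:
  fixes X :: "'a topology" and ori :: "'a \<Rightarrow> 'a chain set" and P :: "'a set"
    and \<A> \<B> :: "'a set set" and A B :: "'a set" and as bs :: "'a set list"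
    and n m :: nat and N :: "real mat"
  assumes "marked_surface X ori P"
    and "\<A> \<in> multicurve_classes X P" and "\<B> \<in> multicurve_classes X P"
    and "A \<in> \<A>" and "B \<in> \<B>"
    and "transverse X A B" and "meet_minimally X P A B"
    and "fills X P A B"
    and "enumerates as (comps X A)" and "length as = n"
    and "enumerates bs (comps X B)" and "length bs = m"
    and "N = intersection_matrix X P as bs"
  shows "adjacency_matrix (intersection_graph X A B) (map Inl as @ map Inr bs) =
           four_block_mat (0\<^sub>m n n) N (transpose_mat N) (0\<^sub>m m m)
       \<and> mu_union X P A B = sqrt (mu (N * transpose_mat N))
       \<and> sqrt (mu (N * transpose_mat N)) = mu_graph (intersection_graph X A B)"
proof -
  have sub: "A \<subseteq> topspace X" "B \<subseteq> topspace X"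
    using assms by (auto dest: multicurve_classes_subset)
  have adj: "adjacency_matrix (intersection_graph X A B) (map Inl as @ map Inr bs) =
      four_block_mat (0\<^sub>m n n) N (transpose_mat N) (0\<^sub>m m m)"
    using adjacency_matrix_intersection_graph[OF sub] assms by blast
  \<comment> \<open>The tags keep the two sides apart, so the joined list is distinct.\<close>
  have "enumerates (map Inl as @ map Inr bs) (verts (intersection_graph X A B))"
    using assms(9,11) by (auto simp: enumerates_def intersection_graph_def distinct_map)
  then have "mu_graph (intersection_graph X A B)
      = mu (four_block_mat (0\<^sub>m n n) N (transpose_mat N) (0\<^sub>m m m))"
    using adj mu_graph_eq by metis
  also have "\<dots> = sqrt (mu (N * transpose_mat N))"
    using assms by (intro mu_bipartite) (simp add: intersection_matrix_def)
  finally show ?thesis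
    using adj mu_union_eq assms(9,11,13) by metis
qed

end
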